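(* (i) Let $\partial:K\to A$ be a crossed semi-module. For $a\in A$ and $x\in K$ define $${}^{a}x=x,\qquad a\circ x=a\,\partial(x),$$ and keep the given right action $x^{a}$ of $A$ on $K$. This yields a crossed semi-bimodule, denoted by $\Phi(K,A,\partial)$. (ii) Conversely, let $(K,A,\circ)$ be a crossed semi-bimodule for which ${}^{a}x=x$ for all $a\in A$ and $x\in K$. Define $\partial:K\to A$ by $\partial(x)=1\circ x$. Then $\partial$, together with the right action $x^{a}$ of $A$ on $K$, is a crossed semi-module. (iii) The construction in (i) defines a full and faithful functor $\Phi$ from the category of crossed semi-modules to the category of crossed semi-bimodules. Moreover, it induces an isomorphism of the category of crossed semi-modules with the full subcategory of the category of crossed semi-bimodules consisting of those for which ${}^{a}x=x$ for all $a\in A$ and $x\in K$.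
   Context: A crossed semi-module is a monoid homomorphism $\partial:K\to A$ together with a right action $(x,a)\mapsto x^{a}$ of the monoid $A$ on the monoid $K$ (by monoid endomorphisms) such that $a\,\partial(x^{a})=\partial(x)\,a$ and $y\,x^{\partial(y)}=xy$ for all $a\in A$, $x,y\in K$. A morphism from $(\partial:K\to A)$ to $(\partial':K'\to A')$ is a pair of monoid homomorphisms $\kappa:K\to K'$, $\alpha:A\to A'$ with $\alpha\partial=\partial'\kappa$ and $\kappa(x^{a})=\kappa(x)^{\alpha(a)}$. A crossed semi-bimodule $(K,A,\circ)$ consists of monoids $A$ and $K$ (written multiplicatively, units denoted $1$), together with maps $A\times K\to A,\ (a,x)\mapsto a\circ x$; $A\times K\to K,\ (a,x)\mapsto {}^{a}x$; $K\times A\to K,\ (x,a)\mapsto x^{a}$, such that: the first map makes $A$ into a right $K$-set ($a\circ 1=a$, $a\circ(xy)=(a\circ x)\circ y$); the second makes $K$ into a left $A$-monoid (a left action of $A$ on $K$ by monoid endomorphisms: ${}^{1}x=x$, ${}^{ab}x={}^{a}({}^{b}x)$, ${}^{a}(xy)={}^{a}x\,{}^{a}y$, ${}^{a}1=1$); the third makes $K$ into a right $A$-monoid ($x^{1}=x$, $x^{ab}=(x^{a})^{b}$, $(xy)^{a}=x^{a}y^{a}$, $1^{a}=1$); and for all $x,y\in K$, $a,b\in A$: (1) $({}^{a}x)^{b}={}^{a}(x^{b})$; (2) $(ab)\circ({}^{a}x)=a(b\circ x)$; (3) $(ab)\circ(x^{b})=(a\circ x)b$; (4) $({}^{a}y)\,x^{b\circ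 y}=x^{b}\,({}^{a\circ x}y)$. A morphism of crossed semi-bimodules $(K,A,\circ)\to(K',A',\circ)$ is a pair of monoid homomorphisms $\kappa:K\to K'$, $\alpha:A\to A'$ with $\alpha(a\circ x)=\alpha(a)\circ\kappa(x)$, $\kappa({}^{a}x)={}^{\alpha(a)}\kappa(x)$ and $\kappa(x^{a})=\kappa(x)^{\alpha(a)}$. *)

theory Defs
  imports "HOL-Algebra.Group" "HOL-Library.FuncSet"
begin

section \<open>Monoid homomorphisms and actions\<close>

text \<open>\<open>hom\<close> of HOL-Algebra only asks for compatibility with multiplication; homomorphisms of
  monoids also preserve the unit.\<close>

definition monoid_hom :: "'a monoid \<Rightarrow> 'b monoid \<Rightarrow> ('a \<Rightarrow> 'b) set" where
  "monoid_hom G H = {h \<in> hom G H. h \<one>\<^bsub>G\<^esub> = \<one>\<^bsub>H\<^esub>}"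

definition right_monoid_set :: "'k monoid \<Rightarrow> 's set \<Rightarrow> ('s \<Rightarrow> 'k \<Rightarrow> 's) \<Rightarrow> bool" where
  "right_monoid_set K S c \<longleftrightarrow>
     c \<in> S \<rightarrow> carrier K \<rightarrow> S \<and>
     (\<forall>s\<in>S. c s \<one>\<^bsub>K\<^esub> = s) \<and>
     (\<forall>s\<in>S. \<forall>x\<in>carrier K. \<forall>y\<in>carrier K. c s (x \<otimes>\<^bsub>K\<^esub> y) = c (c s x) y)"

definition left_action_by_endos :: "'a monoid \<Rightarrow> 'k monoid \<Rightarrow> ('a \<Rightarrow> 'k \<Rightarrow> 'k) \<Rightarrow> bool" where
  "left_action_by_endos A K l \<longleftrightarrow>
     (\<forall>a\<in>carrier A. (\<lambda>x. l a x) \<in> monoid_hom K K) \<and>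
     (\<forall>x\<in>carrier K. l \<one>\<^bsub>A\<^esub> x = x) \<and>
     (\<forall>a\<in>carrier A. \<forall>b\<in>carrier A. \<forall>x\<in>carrier K. l (a \<otimes>\<^bsub>A\<^esub> b) x = l a (l b x))"

definition right_action_by_endos :: "'a monoid \<Rightarrow> 'k monoid \<Rightarrow> ('k \<Rightarrow> 'a \<Rightarrow> 'k) \<Rightarrow> bool" where
  "right_action_by_endos A K r \<longleftrightarrow>
     (\<forall>a\<in>carrier A. (\<lambda>x. r x a) \<in> monoid_hom K K) \<and>
     (\<forall>x\<in>carrier K. r x \<one>\<^bsub>A\<^esub> = x) \<and>
     (\<forall>a\<in>carrier A. \<forall>b\<in>carrier A. \<forall>x\<in>carrier K. r x (a \<otimes>\<^bsub>A\<^esub> b) = r (r x a) b)"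


section \<open>Crossed semi-modules and crossed semi-bimodules\<close>

text \<open>\<open>ract x a\<close> is \<open>x\<^sup>a\<close>, \<open>lact a x\<close> is the left action of \<open>a\<close> on \<open>x\<close>, and \<open>circ a x\<close> is
  \<open>a \<circ> x\<close>.\<close>

record ('k, 'a) smod =
  Kmon :: "'k monoid"
  Amon :: "'a monoid"
  bdry :: "'k \<Rightarrow> 'a"
  ract :: "'k \<Rightarrow> 'a \<Rightarrow> 'k"

record ('k, 'a) sbimod =
  bKmon :: "'k monoid"
  bAmon :: "'a monoid"
  circ :: "'a \<Rightarrow> 'k \<Rightarrow> 'a"
  lact :: "'a \<Rightarrow> 'k \<Rightarrow> 'k"
  bract :: "'k \<Rightarrow> 'a \<Rightarrow> 'k"

definition crossed_semimodule :: "('k, 'a) smod \<Rightarrow> bool" where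
  "crossed_semimodule M \<longleftrightarrow>
    (let K = Kmon M; A = Amon M; d = bdry M; r = ract M in
       monoid K \<and> monoid A \<and>
       d \<in> monoid_hom K A \<and>
       right_action_by_endos A K r \<and>
       (\<forall>a\<in>carrier A. \<forall>x\<in>carrier K. a \<otimes>\<^bsub>A\<^esub> d (r x a) = d x \<otimes>\<^bsub>A\<^esub> a) \<and>
       (\<forall>x\<in>carrier K. \<forall>y\<in>carrier K. y \<otimes>\<^bsub>K\<^esub> r x (d y) = x \<otimes>\<^bsub>K\<^esub> y))"

definition crossed_semibimodule :: "('k, 'a) sbimod \<Rightarrow> bool" where
  "crossed_semibimodule B \<longleftrightarrow>
    (let K = bKmon B; A = bAmon B; c = circ B; l = lact B; r = bract B in
       monoid K \<and> monoid A \<and>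
       right_monoid_set K (carrier A) c \<and>
       left_action_by_endos A K l \<and>
       right_action_by_endos A K r \<and>
       (\<forall>a\<in>carrier A. \<forall>b\<in>carrier A. \<forall>x\<in>carrier K. r (l a x) b = l a (r x b)) \<and>
       (\<forall>a\<in>carrier A. \<forall>b\<in>carrier A. \<forall>x\<in>carrier K.
          c (a \<otimes>\<^bsub>A\<^esub> b) (l a x) = a \<otimes>\<^bsub>A\<^esub> c b x) \<and>
       (\<forall>a\<in>carrier A. \<forall>b\<in>carrier A. \<forall>x\<in>carrier K.
          c (a \<otimes>\<^bsub>A\<^esub> b) (r x b) = c a x \<otimes>\<^bsub>A\<^esub> b) \<and>
       (\<forall>a\<in>carrier A. \<forall>b\<in>carrier A. \<forall>x\<in>carrier K. \<forall>y\<in>carrier K.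
          l a y \<otimes>\<^bsub>K\<^esub> r x (c b y) = r x b \<otimes>\<^bsub>K\<^esub> l (c a x) y))"

definition trivial_lact :: "('k, 'a) sbimod \<Rightarrow> bool" where
  "trivial_lact B \<longleftrightarrow> (\<forall>a\<in>carrier (bAmon B). \<forall>x\<in>carrier (bKmon B). lact B a x = x)"

text \<open>The new operations are \<open>restrict\<close>ed, i.e. take the value \<open>undefined\<close> off the carriers, so
  that the constructions stay within the normalized objects used for the categories below.\<close>

definition Phi :: "('k, 'a) smod \<Rightarrow> ('k, 'a) sbimod" where
  "Phi M = \<lparr> bKmon = Kmon M, bAmon = Amon M,
             circ = (\<lambda>a\<in>carrier (Amon M). \<lambda>x\<in>carrier (Kmon M). a \<otimes>\<^bsub>Amon M\<^esub> bdry M x),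
             lact = (\<lambda>a\<in>carrier (Amon M). \<lambda>x\<in>carrier (Kmon M). x),
             bract = ract M \<rparr>"

definition semimodule_of :: "('k, 'a) sbimod \<Rightarrow> ('k, 'a) smod" where
  "semimodule_of B = \<lparr> Kmon = bKmon B, Amon = bAmon B,
             bdry = (\<lambda>x\<in>carrier (bKmon B). circ B \<one>\<^bsub>bAmon B\<^esub> x),
             ract = bract B \<rparr>"


section \<open>Categories and functors\<close>

text \<open>Categories are given by hom-sets. The hom-sets for different pairs of objects need not be
  disjoint as sets; composition, identities and the arrow part of a functor are therefore indexed
  by the objects. \<open>Comp C X Y Z g f\<close> is \<open>g\<close> after \<open>f\<close>, for \<open>f : X \<rightarrow> Y\<close> and \<open>g : Y \<rightarrow> Z\<close>.\<close>

record ('o, 'm) cat =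
  Ob :: "'o set"
  Hom :: "'o \<Rightarrow> 'o \<Rightarrow> 'm set"
  Id :: "'o \<Rightarrow> 'm"
  Comp :: "'o \<Rightarrow> 'o \<Rightarrow> 'o \<Rightarrow> 'm \<Rightarrow> 'm \<Rightarrow> 'm"

definition is_category :: "('o, 'm) cat \<Rightarrow> bool" where
  "is_category C \<longleftrightarrow>
     (\<forall>X\<in>Ob C. Id C X \<in> Hom C X X) \<and>
     (\<forall>X\<in>Ob C. \<forall>Y\<in>Ob C. \<forall>Z\<in>Ob C. \<forall>f\<in>Hom C X Y. \<forall>g\<in>Hom C Y Z.
        Comp C X Y Z g f \<in> Hom C X Z) \<and>
     (\<forall>X\<in>Ob C. \<forall>Y\<in>Ob C. \<forall>f\<in>Hom C X Y.
        Comp C X X Y f (Id C X) = f \<and> Comp C X Y Y (Id C Y) f = f) \<and>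
     (\<forall>W\<in>Ob C. \<forall>X\<in>Ob C. \<forall>Y\<in>Ob C. \<forall>Z\<in>Ob C.
        \<forall>f\<in>Hom C W X. \<forall>g\<in>Hom C X Y. \<forall>h\<in>Hom C Y Z.
        Comp C W Y Z h (Comp C W X Y g f) = Comp C W X Z (Comp C X Y Z h g) f)"

definition is_functor ::
  "('o, 'm) cat \<Rightarrow> ('p, 'n) cat \<Rightarrow> ('o \<Rightarrow> 'p) \<Rightarrow> ('o \<Rightarrow> 'o \<Rightarrow> 'm \<Rightarrow> 'n) \<Rightarrow> bool" where
  "is_functor C D F Fa \<longleftrightarrow>
     is_category C \<and> is_category D \<and>
     (\<forall>X\<in>Ob C. F X \<in> Ob D) \<and>
     (\<forall>X\<in>Ob C. \<forall>Y\<in>Ob C. \<forall>f\<in>Hom C X Y. Fa X Y f \<in> Hom D (F X) (F Y)) \<and>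
     (\<forall>X\<in>Ob C. Fa X X (Id C X) = Id D (F X)) \<and>
     (\<forall>X\<in>Ob C. \<forall>Y\<in>Ob C. \<forall>Z\<in>Ob C. \<forall>f\<in>Hom C X Y. \<forall>g\<in>Hom C Y Z.
        Fa X Z (Comp C X Y Z g f) = Comp D (F X) (F Y) (F Z) (Fa Y Z g) (Fa X Y f))"

definition is_faithful ::
  "('o, 'm) cat \<Rightarrow> ('o \<Rightarrow> 'o \<Rightarrow> 'm \<Rightarrow> 'n) \<Rightarrow> bool" where
  "is_faithful C Fa \<longleftrightarrow> (\<forall>X\<in>Ob C. \<forall>Y\<in>Ob C. inj_on (Fa X Y) (Hom C X Y))"

definition is_full ::
  "('o, 'm) cat \<Rightarrow> ('p, 'n) cat \<Rightarrow> ('o \<Rightarrow> 'p) \<Rightarrow> ('o \<Rightarrow> 'o \<Rightarrow> 'm \<Rightarrow> 'n) \<Rightarrow> bool" where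
  "is_full C D F Fa \<longleftrightarrow>
     (\<forall>X\<in>Ob C. \<forall>Y\<in>Ob C. Fa X Y ` Hom C X Y = Hom D (F X) (F Y))"

definition is_cat_isomorphism ::
  "('o, 'm) cat \<Rightarrow> ('p, 'n) cat \<Rightarrow> ('o \<Rightarrow> 'p) \<Rightarrow> ('o \<Rightarrow> 'o \<Rightarrow> 'm \<Rightarrow> 'n) \<Rightarrow> bool" where
  "is_cat_isomorphism C D F Fa \<longleftrightarrow>
     is_functor C D F Fa \<and>
     (\<exists>G Ga. is_functor D C G Ga \<and>
        (\<forall>X\<in>Ob C. G (F X) = X) \<and>
        (\<forall>X\<in>Ob C. \<forall>Y\<in>Ob C. \<forall>f\<in>Hom C X Y. Ga (F X) (F Y) (Fa X Y f) = f) \<and>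
        (\<forall>X\<in>Ob D. F (G X) = X) \<and>
        (\<forall>X\<in>Ob D. \<forall>Y\<in>Ob D. \<forall>f\<in>Hom D X Y. Fa (G X) (G Y) (Ga X Y f) = f))"

definition full_subcat :: "('o, 'm) cat \<Rightarrow> ('o \<Rightarrow> bool) \<Rightarrow> ('o, 'm) cat" where
  "full_subcat C P = C\<lparr> Ob := {X \<in> Ob C. P X} \<rparr>"


section \<open>The two categories\<close>

text \<open>An algebraic structure consists of operations defined on the underlying sets only, whereas
  a record field is a total HOL function. To have equality of records coincide with equality of
  structures (which matters for isomorphism, as opposed to equivalence, of categories), the
  objects of the categories are those whose operations are \<open>undefined\<close> off the carriers; every
  structure is represented by exactly one such record. The same is done for morphisms.\<close>

definition normal_monoid :: "'a monoid \<Rightarrow> bool" where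
  "normal_monoid G \<longleftrightarrow> mult G \<in> carrier G \<rightarrow>\<^sub>E carrier G \<rightarrow>\<^sub>E carrier G"

definition normal_smod :: "('k, 'a) smod \<Rightarrow> bool" where
  "normal_smod M \<longleftrightarrow>
    (let K = Kmon M; A = Amon M in
       normal_monoid K \<and> normal_monoid A \<and>
       bdry M \<in> carrier K \<rightarrow>\<^sub>E carrier A \<and>
       ract M \<in> carrier K \<rightarrow>\<^sub>E carrier A \<rightarrow>\<^sub>E carrier K)"

definition normal_sbimod :: "('k, 'a) sbimod \<Rightarrow> bool" where
  "normal_sbimod B \<longleftrightarrow>
    (let K = bKmon B; A = bAmon B in
       normal_monoid K \<and> normal_monoid A \<and>
       circ B \<in> carrier A \<rightarrow>\<^sub>E carrier K \<rightarrow>\<^sub>E carrier A \<and>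
       lact B \<in> carrier A \<rightarrow>\<^sub>E carrier K \<rightarrow>\<^sub>E carrier K \<and>
       bract B \<in> carrier K \<rightarrow>\<^sub>E carrier A \<rightarrow>\<^sub>E carrier K)"

definition smod_hom ::
  "('k, 'a) smod \<Rightarrow> ('k, 'a) smod \<Rightarrow> (('k \<Rightarrow> 'k) \<times> ('a \<Rightarrow> 'a)) set" where
  "smod_hom M N = {(\<kappa>, \<alpha>).
     \<kappa> \<in> monoid_hom (Kmon M) (Kmon N) \<and> \<kappa> \<in> extensional (carrier (Kmon M)) \<and>
     \<alpha> \<in> monoid_hom (Amon M) (Amon N) \<and> \<alpha> \<in> extensional (carrier (Amon M)) \<and>
     (\<forall>x\<in>carrier (Kmon M). \<alpha> (bdry M x) = bdry N (\<kappa> x)) \<and>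
     (\<forall>x\<in>carrier (Kmon M). \<forall>a\<in>carrier (Amon M). \<kappa> (ract M x a) = ract N (\<kappa> x) (\<alpha> a))}"

definition sbimod_hom ::
  "('k, 'a) sbimod \<Rightarrow> ('k, 'a) sbimod \<Rightarrow> (('k \<Rightarrow> 'k) \<times> ('a \<Rightarrow> 'a)) set" where
  "sbimod_hom B C = {(\<kappa>, \<alpha>).
     \<kappa> \<in> monoid_hom (bKmon B) (bKmon C) \<and> \<kappa> \<in> extensional (carrier (bKmon B)) \<and>
     \<alpha> \<in> monoid_hom (bAmon B) (bAmon C) \<and> \<alpha> \<in> extensional (carrier (bAmon B)) \<and>
     (\<forall>x\<in>carrier (bKmon B). \<forall>a\<in>carrier (bAmon B). \<alpha> (circ B a x) = circ C (\<alpha> a) (\<kappa> x)) \<and>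
     (\<forall>x\<in>carrier (bKmon B). \<forall>a\<in>carrier (bAmon B). \<kappa> (lact B a x) = lact C (\<alpha> a) (\<kappa> x)) \<and>
     (\<forall>x\<in>carrier (bKmon B). \<forall>a\<in>carrier (bAmon B). \<kappa> (bract B x a) = bract C (\<kappa> x) (\<alpha> a))}"

definition SMod :: "(('k, 'a) smod, ('k \<Rightarrow> 'k) \<times> ('a \<Rightarrow> 'a)) cat" where
  "SMod = \<lparr> Ob = {M. crossed_semimodule M \<and> normal_smod M},
            Hom = smod_hom,
            Id = (\<lambda>M. (\<lambda>x\<in>carrier (Kmon M). x, \<lambda>a\<in>carrier (Amon M). a)),
            Comp = (\<lambda>M N P g f. (compose (carrier (Kmon M)) (fst g) (fst f),
                                 compose (carrier (Amon M)) (snd g) (snd f))) \<rparr>"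

definition SBimod :: "(('k, 'a) sbimod, ('k \<Rightarrow> 'k) \<times> ('a \<Rightarrow> 'a)) cat" where
  "SBimod = \<lparr> Ob = {B. crossed_semibimodule B \<and> normal_sbimod B},
              Hom = sbimod_hom,
              Id = (\<lambda>B. (\<lambda>x\<in>carrier (bKmon B). x, \<lambda>a\<in>carrier (bAmon B). a)),
              Comp = (\<lambda>B C D g f. (compose (carrier (bKmon B)) (fst g) (fst f),
                                   compose (carrier (bAmon B)) (snd g) (snd f))) \<rparr>"

text \<open>On morphisms, \<open>\<Phi>\<close> keeps the pair \<open>(\<kappa>, \<alpha>)\<close>.\<close>

definition Phi_arr ::
  "('k, 'a) smod \<Rightarrow> ('k, 'a) smod \<Rightarrow> ('k \<Rightarrow> 'k) \<times> ('a \<Rightarrow> 'a) \<Rightarrow> ('k \<Rightarrow> 'k) \<times> ('a \<Rightarrow> 'a)" where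
  "Phi_arr M N = (\<lambda>(\<kappa>, \<alpha>). (\<kappa>, \<alpha>))"

end

theory Submission
  imports Defs
begin

text \<open>When the left action is trivial, axiom (2) with \<open>b = 1\<close> reads \<open>a \<circ> x = a (1 \<circ> x)\<close>, so
  \<open>\<circ>\<close> is determined by \<open>\<partial> x = 1 \<circ> x\<close>; axioms (3) and (4) at \<open>1\<close> are the two axioms of a crossed
  semi-module, and a pair \<open>(\<kappa>, \<alpha>)\<close> respects \<open>\<circ>\<close> iff it respects \<open>\<partial>\<close>. Hence \<open>\<Phi>\<close> is the identity
  on hom-sets, and the category axioms for crossed semi-modules are inherited from those for
  crossed semi-bimodules.\<close>

section \<open>Monoid homomorphisms, their identities and restricted composites\<close>

lemma monoid_hom_closed: "h \<in> monoid_hom G H \<Longrightarrow> x \<in> carrier G \<Longrightarrow> h x \<in> carrier H"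
  by (auto simp: monoid_hom_def hom_def)

lemma monoid_hom_mult:
  "h \<in> monoid_hom G H \<Longrightarrow> x \<in> carrier G \<Longrightarrow> y \<in> carrier G \<Longrightarrow>
    h (x \<otimes>\<^bsub>G\<^esub> y) = h x \<otimes>\<^bsub>H\<^esub> h y"
  by (auto simp: monoid_hom_def hom_def)

lemma monoid_hom_one: "h \<in> monoid_hom G H \<Longrightarrow> h \<one>\<^bsub>G\<^esub> = \<one>\<^bsub>H\<^esub>"
  by (auto simp: monoid_hom_def)

lemma monoid_homI:
  assumes "\<And>x. x \<in> carrier G \<Longrightarrow> h x \<in> carrier H"
    and "\<And>x y. x \<in> carrier G \<Longrightarrow> y \<in> carrier G \<Longrightarrow> h (x \<otimes>\<^bsub>G\<^esub> y) = h x \<otimes>\<^bsub>H\<^esub> h y"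
    and "h \<one>\<^bsub>G\<^esub> = \<one>\<^bsub>H\<^esub>"
  shows "h \<in> monoid_hom G H"
  using assms by (auto simp: monoid_hom_def hom_def)

lemma monoid_hom_id: "monoid G \<Longrightarrow> (\<lambda>x\<in>carrier G. x) \<in> monoid_hom G G"
  by (rule monoid_homI) (simp_all add: monoid.m_closed monoid.one_closed)

lemma monoid_hom_compose:
  assumes "monoid G" "f \<in> monoid_hom G H" "g \<in> monoid_hom H J"
  shows "compose (carrier G) g f \<in> monoid_hom G J"
proof -
  interpret monoid G by fact
  show ?thesis
    using assms(2,3)
    by (intro monoid_homI)
      (simp_all add: compose_def monoid_hom_closed monoid_hom_mult monoid_hom_one)
qed

section \<open>The two constructions on objects\<close>

lemma crossed_semibimodule_Phi:
  assumes "crossed_semimodule M"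
  shows "crossed_semibimodule (Phi M)"
proof -
  define K A d r where defs: "K = Kmon M" "A = Amon M" "d = bdry M" "r = ract M"
  have K: "monoid K" and A: "monoid A" and d: "d \<in> monoid_hom K A"
    and r: "right_action_by_endos A K r"
    and eq1: "\<And>a x. a \<in> carrier A \<Longrightarrow> x \<in> carrier K \<Longrightarrow> a \<otimes>\<^bsub>A\<^esub> d (r x a) = d x \<otimes>\<^bsub>A\<^esub> a"
    and eq2: "\<And>x y. x \<in> carrier K \<Longrightarrow> y \<in> carrier K \<Longrightarrow>
      y \<otimes>\<^bsub>K\<^esub> r x (d y) = x \<otimes>\<^bsub>K\<^esub> y"
    using assms unfolding crossed_semimodule_def Let_def defs by blast+
  interpret K: monoid K by fact
  interpret A: monoid A by fact
  have r_closed: "r x a \<in> carrier K" if "x \<in> carrier K" "a \<in> carrier A" for x a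
    using r that by (auto simp: right_action_by_endos_def dest: monoid_hom_closed)
  have r_mult: "r x (a \<otimes>\<^bsub>A\<^esub> b) = r (r x a) b"
    if "x \<in> carrier K" "a \<in> carrier A" "b \<in> carrier A" for x a b
    using r that by (auto simp: right_action_by_endos_def)
  note dsimps = monoid_hom_closed[OF d] monoid_hom_mult[OF d] monoid_hom_one[OF d]
  have Phi: "Phi M = \<lparr>bKmon = K, bAmon = A,
      circ = (\<lambda>a\<in>carrier A. \<lambda>x\<in>carrier K. a \<otimes>\<^bsub>A\<^esub> d x),
      lact = (\<lambda>a\<in>carrier A. \<lambda>x\<in>carrier K. x), bract = r\<rparr>"
    by (simp add: Phi_def defs)
  have circ_set: "right_monoid_set K (carrier A) (circ (Phi M))"
    by (auto simp: right_monoid_set_def Phi dsimps A.m_assoc)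
  have lact_endo: "left_action_by_endos A K (lact (Phi M))"
    by (auto simp: left_action_by_endos_def Phi intro!: monoid_homI)
  \<comment> \<open>Axiom (3): after reassociating, \<open>eq1\<close> exchanges \<open>b\<close>
    times \<open>d (r x b)\<close> for \<open>d x\<close> times \<open>b\<close>.\<close>
  have circ_ract: "(a \<otimes>\<^bsub>A\<^esub> b) \<otimes>\<^bsub>A\<^esub> d (r x b) = (a \<otimes>\<^bsub>A\<^esub> d x) \<otimes>\<^bsub>A\<^esub> b"
    if "a \<in> carrier A" "b \<in> carrier A" "x \<in> carrier K" for a b x
    using that by (simp add: A.m_assoc dsimps r_closed eq1)
  \<comment> \<open>Axiom (4) now asks that \<open>y\<close> times \<open>r x\<close> at the product
    of \<open>b\<close> and \<open>d y\<close> be \<open>r x b\<close> times \<open>y\<close>.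
    \<open>r_mult\<close> splits the action of this product into two actions, and \<open>eq2\<close>
    applies with \<open>r x b\<close> in place of \<open>x\<close>. Axiom (2) is associativity in
    \<open>A\<close>.\<close>
  show ?thesis
    unfolding crossed_semibimodule_def Let_def
    using circ_set lact_endo r K A
    by (simp add: Phi A.m_assoc[symmetric] dsimps r_closed circ_ract r_mult eq2)
qed

lemma trivial_lact_Phi: "trivial_lact (Phi M)"
  by (simp add: trivial_lact_def Phi_def)

text \<open>Reduces statements about \<circ> to statements about \<partial>. It serves both to
  derive the semi-module axioms and to show that \<Phi> recovers the original \<circ>.\<close>

lemma circ_eq_one_circ:
  assumes "crossed_semibimodule B" "trivial_lact B"
    and "a \<in> carrier (bAmon B)" "x \<in> carrier (bKmon B)"
  shows "circ B a x = a \<otimes>\<^bsub>bAmon B\<^esub> circ B \<one>\<^bsub>bAmon B\<^esub> x"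
proof -
  have A: "monoid (bAmon B)"
    and eq: "circ B (a \<otimes>\<^bsub>bAmon B\<^esub> \<one>\<^bsub>bAmon B\<^esub>) (lact B a x) = a \<otimes>\<^bsub>bAmon B\<^esub> circ B \<one>\<^bsub>bAmon B\<^esub> x"
    using assms monoid.one_closed unfolding crossed_semibimodule_def Let_def by blast+
  from A eq show ?thesis
    using assms by (simp add: trivial_lact_def monoid.r_one)
qed

lemma crossed_semimodule_semimodule_of:
  assumes B: "crossed_semibimodule B" and triv: "trivial_lact B"
  shows "crossed_semimodule (semimodule_of B)"
proof -
  define K A c r where defs: "K = bKmon B" "A = bAmon B" "c = circ B" "r = bract B"
  define d where "d = c \<one>\<^bsub>A\<^esub>"
  have K: "monoid K" and A: "monoid A" and c: "right_monoid_set K (carrier A) c"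
    and r: "right_action_by_endos A K r"
    and eq3: "\<And>a b x. a \<in> carrier A \<Longrightarrow> b \<in> carrier A \<Longrightarrow> x \<in> carrier K \<Longrightarrow>
      c (a \<otimes>\<^bsub>A\<^esub> b) (r x b) = c a x \<otimes>\<^bsub>A\<^esub> b"
    and eq4: "\<And>a b x y. a \<in> carrier A \<Longrightarrow> b \<in> carrier A \<Longrightarrow> x \<in> carrier K \<Longrightarrow> y \<in> carrier K \<Longrightarrow>
      lact B a y \<otimes>\<^bsub>K\<^esub> r x (c b y) = r x b \<otimes>\<^bsub>K\<^esub> lact B (c a x) y"
    using B unfolding crossed_semibimodule_def Let_def defs by blast+
  interpret K: monoid K by fact
  interpret A: monoid A by fact
  have r_closed: "r x a \<in> carrier K" if "x \<in> carrier K" "a \<in> carrier A" for x a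
    using r that by (auto simp: right_action_by_endos_def dest: monoid_hom_closed)
  have c_eq: "c a x = a \<otimes>\<^bsub>A\<^esub> d x" if "a \<in> carrier A" "x \<in> carrier K" for a x
    using circ_eq_one_circ[OF B triv] that by (simp add: defs d_def)
  have d_closed: "d x \<in> carrier A" if "x \<in> carrier K" for x
    using c that by (auto simp: right_monoid_set_def d_def Pi_iff)
  have d_hom: "(\<lambda>x\<in>carrier K. d x) \<in> monoid_hom K A"
  proof (rule monoid_homI)
    fix x y assume xy: "x \<in> carrier K" "y \<in> carrier K"
    \<comment> \<open>The law of a right \<open>K\<close>-set, applied at the unit of
      \<open>A\<close>; \<open>c_eq\<close> then turns the remaining action of \<open>y\<close> into
      multiplication by \<open>d y\<close>.\<close>
    have "d (x \<otimes>\<^bsub>K\<^esub> y) = c (d x) y"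
      using c xy by (simp add: right_monoid_set_def d_def)
    also have "\<dots> = d x \<otimes>\<^bsub>A\<^esub> d y"
      using xy by (simp add: c_eq d_closed)
    finally show "(\<lambda>x\<in>carrier K. d x) (x \<otimes>\<^bsub>K\<^esub> y) =
        (\<lambda>x\<in>carrier K. d x) x \<otimes>\<^bsub>A\<^esub> (\<lambda>x\<in>carrier K. d x) y"
      using xy by simp
  qed (use c in \<open>auto simp: d_closed right_monoid_set_def d_def Pi_iff\<close>)
  \<comment> \<open>Only the first element of \<open>A\<close> in axiom (3) is set to 1; the second
    stays arbitrary and becomes the \<open>a\<close> of the semi-module axiom.\<close>
  have eq1: "a \<otimes>\<^bsub>A\<^esub> d (r x a) = d x \<otimes>\<^bsub>A\<^esub> a" if "a \<in> carrier A" "x \<in> carrier K" for a x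
    using eq3[of "\<one>\<^bsub>A\<^esub>" a x] that by (simp add: c_eq r_closed d_closed)
  have r_one: "r x \<one>\<^bsub>A\<^esub> = x" if "x \<in> carrier K" for x
    using r that by (simp add: right_action_by_endos_def)
  have lact: "lact B a x = x" if "a \<in> carrier A" "x \<in> carrier K" for a x
    using triv that by (simp add: trivial_lact_def defs)
  \<comment> \<open>In axiom (4) both elements of \<open>A\<close> are set to 1, so that the
    exponents become \<open>d y\<close> on the left and 1 on the right.\<close>
  have eq2: "y \<otimes>\<^bsub>K\<^esub> r x (d y) = x \<otimes>\<^bsub>K\<^esub> y" if "x \<in> carrier K" "y \<in> carrier K" for x y
    using eq4[of "\<one>\<^bsub>A\<^esub>" "\<one>\<^bsub>A\<^esub>" x y] that
    by (simp add: c_eq r_one d_closed lact)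
  have "semimodule_of B = \<lparr>Kmon = K, Amon = A, bdry = (\<lambda>x\<in>carrier K. d x), ract = r\<rparr>"
    by (simp add: semimodule_of_def defs d_def)
  then show ?thesis
    using K A r d_hom by (simp add: crossed_semimodule_def eq1 eq2 r_closed)
qed

section \<open>Normalized objects: the constructions are mutually inverse and keep the
  hom-sets\<close>

lemma normal_sbimod_Phi:
  assumes "crossed_semimodule M" "normal_smod M"
  shows "normal_sbimod (Phi M)"
proof -
  have "a \<otimes>\<^bsub>Amon M\<^esub> bdry M x \<in> carrier (Amon M)"
    if "a \<in> carrier (Amon M)" "x \<in> carrier (Kmon M)" for a x
    using assms(1) that
    by (auto simp: crossed_semimodule_def Let_def intro: monoid.m_closed monoid_hom_closed)
  then show ?thesis
    using assms(2) by (simp add: normal_sbimod_def normal_smod_def Phi_def Let_def)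
qed

lemma normal_smod_semimodule_of:
  assumes "crossed_semibimodule B" "normal_sbimod B"
  shows "normal_smod (semimodule_of B)"
proof -
  have "\<one>\<^bsub>bAmon B\<^esub> \<in> carrier (bAmon B)"
    using assms(1) by (simp add: crossed_semibimodule_def Let_def monoid.one_closed)
  then show ?thesis
    using assms(2)
    by (auto simp: normal_sbimod_def normal_smod_def semimodule_of_def Let_def
        dest: PiE_mem)
qed

text \<open>On the carrier, the recovered boundary is 1 times \<partial>; off the carrier, normality
  makes \<open>bdry M\<close> equal to \<open>undefined\<close>, as the restriction is. This gives
  equality of records and not merely agreement on the carriers.\<close>

lemma semimodule_of_Phi:
  assumes "crossed_semimodule M" "normal_smod M"
  shows "semimodule_of (Phi M) = M"
proof -
  have A: "monoid (Amon M)" using assms(1) by (simp add: crossed_semimodule_def Let_def)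
  have d: "bdry M \<in> carrier (Kmon M) \<rightarrow>\<^sub>E carrier (Amon M)"
    using assms(2) by (simp add: normal_smod_def Let_def)
  have "(\<lambda>x\<in>carrier (Kmon M). circ (Phi M) \<one>\<^bsub>Amon M\<^esub> x) = bdry M"
  proof
    fix x
    show "(\<lambda>x\<in>carrier (Kmon M). circ (Phi M) \<one>\<^bsub>Amon M\<^esub> x) x = bdry M x"
      using A PiE_mem[OF d, of x] PiE_arb[OF d, of x]
      by (auto simp: Phi_def monoid.one_closed monoid.l_one)
  qed
  then show ?thesis
    by (simp add: semimodule_of_def Phi_def)
qed

lemma Phi_semimodule_of:
  assumes "crossed_semibimodule B" "normal_sbimod B" "trivial_lact B"
  shows "Phi (semimodule_of B) = B"
proof -
  have c: "circ B \<in> carrier (bAmon B) \<rightarrow>\<^sub>E carrier (bKmon B) \<rightarrow>\<^sub>E carrier (bAmon B)"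
    and l: "lact B \<in> carrier (bAmon B) \<rightarrow>\<^sub>E carrier (bKmon B) \<rightarrow>\<^sub>E carrier (bKmon B)"
    using assms(2) by (simp_all add: normal_sbimod_def Let_def)
  have circ: "circ (Phi (semimodule_of B)) = circ B"
  proof (intro ext)
    fix a x
    show "circ (Phi (semimodule_of B)) a x = circ B a x"
    \<comment> \<open>Extensionality is nested: for \<open>a\<close> off the carrier the whole
      function \<open>circ B a\<close> is \<open>undefined\<close>, while for \<open>a\<close> in
      the carrier only its values off the carrier of \<open>K\<close> are.\<close>
    proof (cases "a \<in> carrier (bAmon B)")
      case True
      with PiE_arb[OF PiE_mem[OF c True], of x] circ_eq_one_circ[OF assms(1,3) True, of x]
      show ?thesis by (auto simp: Phi_def semimodule_of_def)
    qed (use PiE_arb[OF c] in \<open>simp add: Phi_def semimodule_of_def\<close>)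
  qed
  have lact: "lact (Phi (semimodule_of B)) = lact B"
  proof (intro ext)
    fix a x
    show "lact (Phi (semimodule_of B)) a x = lact B a x"
    proof (cases "a \<in> carrier (bAmon B)")
      case True
      with PiE_arb[OF PiE_mem[OF l True], of x] assms(3)
      show ?thesis by (auto simp: Phi_def semimodule_of_def trivial_lact_def)
    qed (use PiE_arb[OF l] in \<open>simp add: Phi_def semimodule_of_def\<close>)
  qed
  show ?thesis
    using circ lact by (intro sbimod.equality) (simp_all add: Phi_def semimodule_of_def)
qed

text \<open>Both left actions are trivial and the right actions are unchanged, so the two notions of
  morphism can differ only in preserving \<circ> versus preserving \<partial>. Taking
  \<open>a\<close> to be the unit leads from \<circ> to \<partial>; multiplicativity of \<alpha>
  leads back.\<close>

lemma sbimod_hom_Phi: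
  assumes M: "crossed_semimodule M" and N: "crossed_semimodule N"
  shows "sbimod_hom (Phi M) (Phi N) = smod_hom M N"
proof -
  interpret A: monoid "Amon M" using M by (simp add: crossed_semimodule_def Let_def)
  interpret A': monoid "Amon N" using N by (simp add: crossed_semimodule_def Let_def)
  have d: "bdry M x \<in> carrier (Amon M)" if "x \<in> carrier (Kmon M)" for x
    using M that by (auto simp: crossed_semimodule_def Let_def dest: monoid_hom_closed)
  have d': "bdry N x \<in> carrier (Amon N)" if "x \<in> carrier (Kmon N)" for x
    using N that by (auto simp: crossed_semimodule_def Let_def dest: monoid_hom_closed)
  have r: "ract M x a \<in> carrier (Kmon M)" if "x \<in> carrier (Kmon M)" "a \<in> carrier (Amon M)" for x a
    using M that
    by (auto simp: crossed_semimodule_def right_action_by_endos_def Let_def dest: monoid_hom_closed)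
  have circ_iff: "(\<forall>x\<in>carrier (Kmon M). \<forall>a\<in>carrier (Amon M).
        \<alpha> (a \<otimes>\<^bsub>Amon M\<^esub> bdry M x) = \<alpha> a \<otimes>\<^bsub>Amon N\<^esub> bdry N (\<kappa> x)) \<longleftrightarrow>
      (\<forall>x\<in>carrier (Kmon M). \<alpha> (bdry M x) = bdry N (\<kappa> x))" (is "?L \<longleftrightarrow> ?R")
    if \<kappa>: "\<kappa> \<in> monoid_hom (Kmon M) (Kmon N)" and \<alpha>: "\<alpha> \<in> monoid_hom (Amon M) (Amon N)" for \<kappa> \<alpha>
  proof
    assume L: ?L
    show ?R
    proof
      fix x assume x: "x \<in> carrier (Kmon M)"
      with L have "\<alpha> (\<one>\<^bsub>Amon M\<^esub> \<otimes>\<^bsub>Amon M\<^esub> bdry M x) = \<alpha> \<one>\<^bsub>Amon M\<^esub> \<otimes>\<^bsub>Amon N\<^esub> bdry N (\<kappa> x)"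
        by blast
      with x show "\<alpha> (bdry M x) = bdry N (\<kappa> x)"
        by (simp add: d d' monoid_hom_one[OF \<alpha>] monoid_hom_closed[OF \<kappa>])
    qed
  qed (simp add: d monoid_hom_mult[OF \<alpha>])
  have "(\<kappa>, \<alpha>) \<in> sbimod_hom (Phi M) (Phi N) \<longleftrightarrow> (\<kappa>, \<alpha>) \<in> smod_hom M N" for \<kappa> \<alpha>
    \<comment> \<open>\<open>circ_iff\<close> is available only for a pair of homomorphisms; for any
      other pair both memberships fail.\<close>
    by (cases "\<kappa> \<in> monoid_hom (Kmon M) (Kmon N) \<and> \<alpha> \<in> monoid_hom (Amon M) (Amon N)")
      (auto simp: sbimod_hom_def smod_hom_def Phi_def monoid_hom_closed r simp flip: circ_iff)
  then show ?thesis by auto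
qed

section \<open>The category axioms\<close>

lemma is_category_full_subcat:
  assumes "is_category C"
  shows "is_category (full_subcat C P)"
  using assms unfolding is_category_def full_subcat_def by simp

lemma is_category_SBimod: "is_category (SBimod :: (('k, 'a) sbimod, _) cat)"
proof -
  have mon: "monoid (bKmon B)" "monoid (bAmon B)"
    and circ: "\<And>a x. a \<in> carrier (bAmon B) \<Longrightarrow> x \<in> carrier (bKmon B) \<Longrightarrow>
      circ B a x \<in> carrier (bAmon B)"
    and lact: "\<And>a x. a \<in> carrier (bAmon B) \<Longrightarrow> x \<in> carrier (bKmon B) \<Longrightarrow>
      lact B a x \<in> carrier (bKmon B)"
    and bract: "\<And>a x. a \<in> carrier (bAmon B) \<Longrightarrow> x \<in> carrier (bKmon B) \<Longrightarrow>
      bract B x a \<in> carrier (bKmon B)"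
    if "B \<in> Ob SBimod" for B :: "('k, 'a) sbimod"
    using that
    by (auto simp: SBimod_def crossed_semibimodule_def normal_sbimod_def Let_def
        dest!: PiE_mem)
  have id: "Id SBimod X \<in> Hom SBimod X X" if "X \<in> Ob SBimod" for X :: "('k, 'a) sbimod"
    using mon[OF that] circ[OF that] lact[OF that] bract[OF that]
    by (simp add: SBimod_def sbimod_hom_def monoid_hom_id)
  \<comment> \<open>Closure of the operations of \<open>X\<close> keeps their results where the
    restricted composite is \<open>g\<close> after \<open>f\<close>, so the two preservation
    equations can be chained.\<close>
  have comp: "Comp SBimod X Y Z g f \<in> Hom SBimod X Z"
    if "X \<in> Ob SBimod" "Y \<in> Ob SBimod" "Z \<in> Ob SBimod" "f \<in> Hom SBimod X Y" "g \<in> Hom SBimod Y Z"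
    for X Y Z :: "('k, 'a) sbimod" and f g
    using that(4,5) mon[OF that(1)] circ[OF that(1)] lact[OF that(1)] bract[OF that(1)]
    by (auto simp: SBimod_def sbimod_hom_def monoid_hom_compose compose_eq monoid_hom_closed)
  \<comment> \<open>On the carriers this is evaluation; off them, the extensionality demanded of
    morphisms makes \<open>f\<close> agree with the restricted composite.\<close>
  have unit: "Comp SBimod X X Y f (Id SBimod X) = f" "Comp SBimod X Y Y (Id SBimod Y) f = f"
    if "f \<in> Hom SBimod X Y" for X Y :: "('k, 'a) sbimod" and f
    using that
    by (auto simp: SBimod_def sbimod_hom_def compose_def fun_eq_iff extensional_def
        monoid_hom_closed)
  \<comment> \<open>Since \<open>f\<close> maps into the carriers of \<open>X\<close>, the
    restriction in the composite of \<open>h\<close> and \<open>g\<close> has no effect at its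
    values.\<close>
  have assoc: "Comp SBimod W Y Z h (Comp SBimod W X Y g f) = Comp SBimod W X Z (Comp SBimod X Y Z h g) f"
    if "f \<in> Hom SBimod W X" for W X Y Z :: "('k, 'a) sbimod" and f g h
    using that by (auto simp: SBimod_def sbimod_hom_def compose_def fun_eq_iff monoid_hom_closed)
  show ?thesis
    unfolding is_category_def by (intro conjI ballI id comp unit assoc)
qed

section \<open>The functor \<Phi>\<close>

lemma Phi_in_Ob: "M \<in> Ob SMod \<Longrightarrow> Phi M \<in> Ob SBimod"
  by (simp add: SMod_def SBimod_def crossed_semibimodule_Phi normal_sbimod_Phi)

lemma semimodule_of_in_Ob: "B \<in> Ob SBimod \<Longrightarrow> trivial_lact B \<Longrightarrow> semimodule_of B \<in> Ob SMod"
  by (simp add: SMod_def SBimod_def crossed_semimodule_semimodule_of normal_smod_semimodule_of)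

lemma Hom_SBimod_Phi:
  "M \<in> Ob SMod \<Longrightarrow> N \<in> Ob SMod \<Longrightarrow> Hom SBimod (Phi M) (Phi N) = Hom SMod M N"
  by (simp add: SMod_def SBimod_def sbimod_hom_Phi)

lemma Id_SBimod_Phi: "Id SBimod (Phi M) = Id SMod M"
  by (simp add: SMod_def SBimod_def Phi_def)

lemma Comp_SBimod_Phi: "Comp SBimod (Phi M) (Phi N) (Phi P) = Comp SMod M N P"
  by (simp add: SMod_def SBimod_def Phi_def)

lemma Phi_arr_eq: "Phi_arr M N f = f"
  by (simp add: Phi_arr_def)

text \<open>Read from right to left, the three preceding comparisons express the arrows, identities
  and composition of \<open>SMod\<close> through those of \<open>SBimod\<close> between objects
  \<open>Phi M\<close>, so each axiom becomes an instance of the one already proved.\<close>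

lemma is_category_SMod: "is_category (SMod :: (('k, 'a) smod, _) cat)"
  using is_category_SBimod[where 'k = 'k and 'a = 'a]
  unfolding is_category_def
  by (simp add: Phi_in_Ob flip: Hom_SBimod_Phi Id_SBimod_Phi Comp_SBimod_Phi)

lemma is_functor_Phi: "is_functor (SMod :: (('k, 'a) smod, _) cat) SBimod Phi Phi_arr"
  by (simp add: is_functor_def is_category_SMod is_category_SBimod Phi_in_Ob Phi_arr_eq
      Hom_SBimod_Phi Id_SBimod_Phi Comp_SBimod_Phi)

section \<open>The isomorphism with the full subcategory\<close>

lemma is_cat_isomorphism_Phi:
  "is_cat_isomorphism (SMod :: (('k, 'a) smod, _) cat) (full_subcat SBimod trivial_lact) Phi Phi_arr"
proof -
  let ?D = "full_subcat SBimod trivial_lact :: (('k, 'a) sbimod, _) cat"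
  have Phi: "is_functor SMod ?D Phi Phi_arr"
    using is_functor_Phi[where 'k = 'k and 'a = 'a]
      is_category_full_subcat[OF is_category_SBimod[where 'k = 'k and 'a = 'a]]
    unfolding is_functor_def by (simp add: full_subcat_def trivial_lact_Phi)
  have GF: "semimodule_of (Phi M) = M" if "M \<in> Ob SMod" for M :: "('k, 'a) smod"
    using that by (simp add: SMod_def semimodule_of_Phi)
  have FG: "Phi (semimodule_of B) = B" if "B \<in> Ob ?D" for B
    using that by (simp add: SBimod_def full_subcat_def Phi_semimodule_of)
  have G: "semimodule_of B \<in> Ob SMod" if "B \<in> Ob ?D" for B
    using that by (simp add: full_subcat_def semimodule_of_in_Ob)
  \<comment> \<open>For hom-sets, identities and composition alike, \<open>FG\<close> writes each
    object of the subcategory as an image under \<Phi>, where the comparison with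
    \<open>SMod\<close> is known.\<close>
  have Hom: "Hom SMod (semimodule_of B) (semimodule_of C) = Hom ?D B C"
    if "B \<in> Ob ?D" "C \<in> Ob ?D" for B C
    using Hom_SBimod_Phi[OF G G, OF that] FG that by (simp add: full_subcat_def)
  have Id: "Id SMod (semimodule_of B) = Id ?D B" if "B \<in> Ob ?D" for B
    using Id_SBimod_Phi[of "semimodule_of B"] FG[OF that] by (simp add: full_subcat_def)
  have Comp: "Comp SMod (semimodule_of B) (semimodule_of C) (semimodule_of E) = Comp ?D B C E"
    if "B \<in> Ob ?D" "C \<in> Ob ?D" "E \<in> Ob ?D" for B C E
    using Comp_SBimod_Phi[of "semimodule_of B" "semimodule_of C" "semimodule_of E"] FG that
    by (simp add: full_subcat_def)
  \<comment> \<open>The inverse functor leaves arrows unchanged, as \<open>Phi_arr\<close> does, so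
    both round trips on arrows are immediate.\<close>
  have "is_functor ?D SMod semimodule_of (\<lambda>_ _ f. f)"
    using G Hom Id Comp
    by (simp add: is_functor_def is_category_SMod is_category_full_subcat is_category_SBimod)
  with Phi GF FG show ?thesis
    unfolding is_cat_isomorphism_def Phi_arr_eq by blast
qed

theorem proposition4p1:
  shows "(\<forall>M :: ('k, 'a) smod. crossed_semimodule M \<longrightarrow> crossed_semibimodule (Phi M)) \<and>
    (\<forall>B :: ('k, 'a) sbimod. crossed_semibimodule B \<and> trivial_lact B \<longrightarrow>
       crossed_semimodule (semimodule_of B)) \<and>
    is_functor (SMod :: (('k, 'a) smod, _) cat) SBimod Phi Phi_arr \<and>
    is_full (SMod :: (('k, 'a) smod, _) cat) SBimod Phi Phi_arr \<and>
    is_faithful (SMod :: (('k, 'a) smod, _) cat) Phi_arr \<and>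
    is_cat_isomorphism (SMod :: (('k, 'a) smod, _) cat) (full_subcat SBimod trivial_lact)
      Phi Phi_arr"
proof (intro conjI)
  \<comment> \<open>As \<open>Phi_arr\<close> fixes every pair of maps, fullness is the equality of
    hom-sets and faithfulness is injectivity of the identity.\<close>
  show "is_full (SMod :: (('k, 'a) smod, _) cat) SBimod Phi Phi_arr"
    by (simp add: is_full_def Phi_arr_eq Hom_SBimod_Phi)
  show "is_faithful (SMod :: (('k, 'a) smod, _) cat) Phi_arr"
    by (simp add: is_faithful_def Phi_arr_eq inj_on_def)
qed (simp_all add: crossed_semibimodule_Phi crossed_semimodule_semimodule_of is_functor_Phi
    is_cat_isomorphism_Phi)

end
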